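(* Let $\mathbf A$ be a real $M\times K$ matrix with no zero column and $\mathbf B$ a real $K\times N$ matrix with no zero row, and let $\mathbf C=\mathbf A\cdot\mathbf B$. Let $\hat{\mathbf C}$ be the result of the inside scaling procedure: form the diagonal matrix $\mathbf D=\operatorname{diag}\left(\sqrt{\max_j|b_{kj}|/\max_i|a_{ik}|}\right)_{k=1,\dots,K}$, set $\mathbf A'=\mathbf A\mathbf D$ and $\mathbf B'=\mathbf D^{-1}\mathbf B$, and compute $\mathbf C=\mathbf A'\cdot\mathbf B'$ with fast matrix multiplication. Then $$\|\hat{\mathbf C}-\mathbf C\|\le O(\epsilon)\,\max_{i,k,j}|a_{ik}|\,|b_{kj}|.$$
   Context: $\|\cdot\|$ is the max-norm, $\|\mathbf X\|=\max_{i,j}|x_{ij}|$, and $\epsilon$ is the machine precision. "Fast matrix multiplication" means any fixed algorithm that, for input matrices $\mathbf X$ ($M\times K$) and $\mathbf Y$ ($K\times N$) with product $\mathbf Z=\mathbf X\mathbf Y$, returns $\hat{\mathbf Z}$ satisfying the norm-wise error bound $|z_{ij}-\hat z_{ij}|\le f_{\mathrm{alg}}(K)\|\mathbf X\|\|\mathbf Y\|\epsilon+O(\epsilon^2)$ for all $i,j$, where $f_{\mathrm{alg}}$ depends only on the algorithm. In this statement $f_{\mathrm{alg}}$ is treated as a fixed quantity, so that this guarantee reads $|z_{ij}-\hat z_{ij}|\le O(\epsilon)\,\|\mathbf X\|\,\|\mathbf Y\|$; here and in the conclusion, $O(\epsilon)$ denotes a quantity bounded by $\epsilon$ times a constant depending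 only on the algorithm and the dimensions, not on the entries of the matrices. It is assumed that there is no numerical error in computing or applying the scaling matrices. *)

theory Defs
  imports "HOL-Analysis.Analysis"
begin

definition max_norm :: "real ^ 'c ^ 'r \<Rightarrow> real" where
  "max_norm X = (MAX (i, j). \<bar>X $ i $ j\<bar>)"

definition diag_mat :: "real ^ 'k \<Rightarrow> real ^ 'k ^ 'k" where
  "diag_mat d = (\<chi> i j. if i = j then d $ i else 0)"

text \<open>
  An algorithm maps a machine precision and two input matrices to the computed product.
  The set \<open>E\<close> collects the machine precisions under consideration, for instance all reals in
  some interval \<open>(0, \<epsilon>\<^sub>0]\<close>. The constant \<open>c\<close> in the error bound may depend on
  the algorithm and (through the index types) on the dimensions, but neither on the precision
  nor on the entries of the matrices.
\<close>

definition fast_matmul ::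
    "real set \<Rightarrow> (real \<Rightarrow> real ^ 'k ^ 'm \<Rightarrow> real ^ 'n ^ 'k \<Rightarrow> real ^ 'n ^ 'm) \<Rightarrow> bool" where
  "fast_matmul E alg \<longleftrightarrow>
     (\<exists>c. \<forall>\<epsilon>\<in>E. \<forall>X Y i j.
        \<bar>(X ** Y) $ i $ j - alg \<epsilon> X Y $ i $ j\<bar> \<le> c * \<epsilon> * max_norm X * max_norm Y)"

definition inside_scaling_matrix :: "real ^ 'k ^ 'm \<Rightarrow> real ^ 'n ^ 'k \<Rightarrow> real ^ 'k ^ 'k" where
  "inside_scaling_matrix A B =
     diag_mat (\<chi> k. sqrt ((MAX j. \<bar>B $ k $ j\<bar>) / (MAX i. \<bar>A $ i $ k\<bar>)))"

text \<open>
  The scaling itself is carried out in exact arithmetic; only the multiplication \<open>alg\<close> is inexact.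
\<close>

definition inside_scaled_product ::
    "(real \<Rightarrow> real ^ 'k ^ 'm \<Rightarrow> real ^ 'n ^ 'k \<Rightarrow> real ^ 'n ^ 'm) \<Rightarrow> real \<Rightarrow>
     real ^ 'k ^ 'm \<Rightarrow> real ^ 'n ^ 'k \<Rightarrow> real ^ 'n ^ 'm" where
  "inside_scaled_product alg \<epsilon> A B =
     (let D = inside_scaling_matrix A B in alg \<epsilon> (A ** D) (matrix_inv D ** B))"

end

theory Submission
  imports Defs
begin

text \<open>
  Write \<open>a\<^sub>k\<close> for the largest modulus in column \<open>k\<close> of \<open>A\<close> and
  \<open>b\<^sub>k\<close> for the largest modulus in row \<open>k\<close> of \<open>B\<close>. The scaling
  balances the two factors: column \<open>k\<close> of \<open>A D\<close> and row \<open>k\<close> of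
  \<open>D\<^sup>-\<^sup>1 B\<close> both have max-norm \<open>sqrt (a\<^sub>k b\<^sub>k)\<close>, and \<open>a\<^sub>k b\<^sub>k\<close> is
  attained as one of the products \<open>\<bar>a\<^sub>i\<^sub>k\<bar> \<bar>b\<^sub>k\<^sub>j\<bar>\<close>. The norm-wise bound for the scaled
  factors, whose exact product is still \<open>A B\<close>, is thus the claimed bound.
\<close>

lemma max_norm_le_iff: "max_norm X \<le> r \<longleftrightarrow> (\<forall>i j. \<bar>X $ i $ j\<bar> \<le> r)"
  unfolding max_norm_def by (subst Max_le_iff) auto

lemma max_norm_nonneg: "0 \<le> max_norm X"
  using max_norm_le_iff[of X "max_norm X"] abs_ge_zero order_trans by blast

lemma matrix_mul_diag_mat: "(A ** diag_mat d) $ i $ k = A $ i $ k * d $ k"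
  unfolding matrix_matrix_mult_def diag_mat_def by (simp add: if_distrib cong: if_cong)

lemma diag_mat_mul_matrix: "(diag_mat d ** B) $ k $ j = d $ k * B $ k $ j"
  unfolding matrix_matrix_mult_def diag_mat_def by (simp add: if_distrib if_distribR cong: if_cong)

lemma diag_mat_mul_inverse:
  assumes "\<And>k. d $ k * e $ k = 1"
  shows "diag_mat d ** diag_mat e = mat 1"
  using assms by (simp add: vec_eq_iff diag_mat_mul_matrix) (simp add: diag_mat_def mat_def)

text \<open>\<open>matrix_inv\<close> is a Hilbert choice, so \<open>B\<close> serves first as a
  witness that the chosen matrix really is an inverse; associativity then forces the choice to
  coincide with \<open>B\<close>.\<close>

lemma matrix_inv_eqI:
  fixes A B :: "'a::semiring_1 ^ 'n ^ 'n"
  assumes "A ** B = mat 1" "B ** A = mat 1"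
  shows "matrix_inv A = B"
proof -
  let ?C = "matrix_inv A"
  have C: "?C ** A = mat 1"
    unfolding matrix_inv_def by (rule someI2[of _ B]) (simp_all add: assms)
  have "?C = ?C ** (A ** B)"
    by (simp add: assms(1))
  also have "\<dots> = B"
    by (simp add: matrix_mul_assoc C)
  finally show ?thesis .
qed

lemma matrix_inv_diag_mat:
  assumes "\<And>k. d $ k \<noteq> 0"
  shows "matrix_inv (diag_mat d) = diag_mat (\<chi> k. inverse (d $ k))"
  using assms by (intro matrix_inv_eqI diag_mat_mul_inverse) auto

text \<open>Together with its counterpart for rows, this makes every quotient under the square root
  in the scaling matrix positive, so that the matrix is invertible.\<close>

lemma max_column_pos:
  fixes A :: "real ^ 'k ^ 'm"
  assumes "column k A \<noteq> 0"
  shows "0 < (MAX i. \<bar>A $ i $ k\<bar>)"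
  using assms by (subst Max_gr_iff) (auto simp: vec_eq_iff column_def)

lemma max_row_pos:
  fixes B :: "real ^ 'n ^ 'k"
  assumes "row k B \<noteq> 0"
  shows "0 < (MAX j. \<bar>B $ k $ j\<bar>)"
  using assms by (subst Max_gr_iff) (auto simp: vec_eq_iff row_def)

text \<open>For fixed \<open>k\<close> the two maxima are attained at indices \<open>i\<close> and
  \<open>j\<close> chosen independently, so their product is itself one of the values on the
  right.\<close>

lemma max_column_mul_max_row_le:
  fixes A :: "real ^ 'k ^ 'm" and B :: "real ^ 'n ^ 'k"
  shows "(MAX i. \<bar>A $ i $ k\<bar>) * (MAX j. \<bar>B $ k $ j\<bar>)
    \<le> (MAX (i, k, j). \<bar>A $ i $ k\<bar> * \<bar>B $ k $ j\<bar>)"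
proof -
  have "(MAX i. \<bar>A $ i $ k\<bar>) \<in> range (\<lambda>i. \<bar>A $ i $ k\<bar>)"
    by (rule Max_in) auto
  then obtain i where i: "(MAX i. \<bar>A $ i $ k\<bar>) = \<bar>A $ i $ k\<bar>" by blast
  have "(MAX j. \<bar>B $ k $ j\<bar>) \<in> range (\<lambda>j. \<bar>B $ k $ j\<bar>)"
    by (rule Max_in) auto
  then obtain j where j: "(MAX j. \<bar>B $ k $ j\<bar>) = \<bar>B $ k $ j\<bar>" by blast
  show ?thesis
    unfolding i j by (rule Max_ge) (auto intro: range_eqI[where x = "(i, k, j)"])
qed

lemma mult_sqrt_divide_self:
  fixes a b :: real
  assumes "0 < a"
  shows "a * sqrt (b / a) = sqrt (a * b)"
  using assms real_sqrt_mult_self[of a]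
  by (simp add: real_sqrt_divide real_sqrt_mult field_simps)

text \<open>Each factor gets the same share \<open>sqrt G\<close>, so multiplying the two norm
  bounds gives \<open>G\<close>, while the inner product \<open>D ** matrix_inv D\<close>
  cancels.\<close>

lemma inside_scaling_balanced:
  fixes A :: "real ^ 'k ^ 'm" and B :: "real ^ 'n ^ 'k"
  assumes A: "\<And>k. column k A \<noteq> 0" and B: "\<And>k. row k B \<noteq> 0"
  defines "D \<equiv> inside_scaling_matrix A B"
    and "G \<equiv> (MAX (i, k, j). \<bar>A $ i $ k\<bar> * \<bar>B $ k $ j\<bar>)"
  shows "(A ** D) ** (matrix_inv D ** B) = A ** B"
    and "max_norm (A ** D) \<le> sqrt G"
    and "max_norm (matrix_inv D ** B) \<le> sqrt G"
proof -
  define a where "a k = (MAX i. \<bar>A $ i $ k\<bar>)" for k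
  define b where "b k = (MAX j. \<bar>B $ k $ j\<bar>)" for k
  define d :: "real ^ 'k" where "d = (\<chi> k. sqrt (b k / a k))"
  have a: "0 < a k" and b: "0 < b k" for k
    using max_column_pos[OF A] max_row_pos[OF B] by (simp_all add: a_def b_def)
  have d: "0 < d $ k" for k
    using a b by (simp add: d_def)
  have D: "D = diag_mat d"
    by (simp add: D_def inside_scaling_matrix_def d_def a_def b_def)
  have D_inv: "matrix_inv D = diag_mat (\<chi> k. inverse (d $ k))"
    unfolding D using d by (intro matrix_inv_diag_mat) (simp add: less_imp_neq[symmetric])
  have "D ** matrix_inv D = mat 1"
    unfolding D_inv unfolding D using d
    by (intro diag_mat_mul_inverse) (simp add: less_imp_neq[symmetric])
  then show "(A ** D) ** (matrix_inv D ** B) = A ** B"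
    by (metis matrix_mul_assoc matrix_mul_rid)
  have G: "sqrt (a k * b k) \<le> sqrt G" for k
    using max_column_mul_max_row_le[of A k B] by (simp add: a_def b_def G_def)
  have "\<bar>(A ** D) $ i $ k\<bar> \<le> sqrt G" for i k
  proof -
    have "\<bar>A $ i $ k\<bar> \<le> a k"
      unfolding a_def by (rule Max_ge) auto
    then have "\<bar>(A ** D) $ i $ k\<bar> \<le> a k * d $ k"
      unfolding D using d[of k] by (simp add: matrix_mul_diag_mat abs_mult)
    also have "\<dots> = sqrt (a k * b k)"
      using a by (simp add: d_def mult_sqrt_divide_self)
    also have "\<dots> \<le> sqrt G" by (rule G)
    finally show ?thesis .
  qed
  then show "max_norm (A ** D) \<le> sqrt G"
    by (simp add: max_norm_le_iff)
  have "\<bar>(matrix_inv D ** B) $ k $ j\<bar> \<le> sqrt G" for k j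
  proof -
    have "\<bar>B $ k $ j\<bar> \<le> b k"
      unfolding b_def by (rule Max_ge) auto
    then have "\<bar>(matrix_inv D ** B) $ k $ j\<bar> \<le> b k * inverse (d $ k)"
      unfolding D_inv using d[of k] by (simp add: diag_mat_mul_matrix abs_mult field_simps)
    \<comment> \<open>The inverse of \<open>sqrt (b k / a k)\<close> is
      \<open>sqrt (a k / b k)\<close>, so the identity used for the columns applies with
      \<open>a k\<close> and \<open>b k\<close> exchanged.\<close>
    also have "\<dots> = sqrt (a k * b k)"
      using b[of k] mult_sqrt_divide_self[of "b k" "a k"]
      by (simp add: d_def real_sqrt_inverse[symmetric] mult.commute)
    also have "\<dots> \<le> sqrt G" by (rule G)
    finally show ?thesis .
  qed
  then show "max_norm (matrix_inv D ** B) \<le> sqrt G"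
    by (simp add: max_norm_le_iff)
qed

theorem proposition6p4:
  fixes alg :: "real \<Rightarrow> real ^ 'k ^ 'm \<Rightarrow> real ^ 'n ^ 'k \<Rightarrow> real ^ 'n ^ 'm"
    and E :: "real set"
  assumes "\<And>\<epsilon>. \<epsilon> \<in> E \<Longrightarrow> \<epsilon> > 0"
    and "fast_matmul E alg"
  shows "\<exists>c. \<forall>\<epsilon>\<in>E. \<forall>(A :: real ^ 'k ^ 'm) (B :: real ^ 'n ^ 'k).
           (\<forall>k. column k A \<noteq> 0) \<longrightarrow> (\<forall>k. row k B \<noteq> 0) \<longrightarrow>
           max_norm (inside_scaled_product alg \<epsilon> A B - A ** B)
             \<le> c * \<epsilon> * (MAX (i, k, j). \<bar>A $ i $ k\<bar> * \<bar>B $ k $ j\<bar>)"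
proof -
  obtain c where c: "\<And>\<epsilon> X Y i j. \<epsilon> \<in> E \<Longrightarrow>
      \<bar>(X ** Y) $ i $ j - alg \<epsilon> X Y $ i $ j\<bar> \<le> c * \<epsilon> * max_norm X * max_norm Y"
    using assms(2) unfolding fast_matmul_def by blast
  show ?thesis
  \<comment> \<open>The given \<open>c\<close> might be negative; its absolute value allows
    monotonicity of products below. It is fixed before the precision and the matrices, hence uniform
    in them.\<close>
  proof (intro exI[of _ "\<bar>c\<bar>"] ballI allI impI)
    fix \<epsilon> and A :: "real ^ 'k ^ 'm" and B :: "real ^ 'n ^ 'k"
    assume \<epsilon>: "\<epsilon> \<in> E" and "\<forall>k. column k A \<noteq> 0" "\<forall>k. row k B \<noteq> 0"
    define D where "D = inside_scaling_matrix A B"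
    define G where "G = (MAX (i, k, j). \<bar>A $ i $ k\<bar> * \<bar>B $ k $ j\<bar>)"
    let ?X = "A ** D" and ?Y = "matrix_inv D ** B"
    have XY: "?X ** ?Y = A ** B" "max_norm ?X \<le> sqrt G" "max_norm ?Y \<le> sqrt G"
      unfolding D_def G_def
      by (rule inside_scaling_balanced; use \<open>\<forall>k. column k A \<noteq> 0\<close> \<open>\<forall>k. row k B \<noteq> 0\<close> in blast)+
    \<comment> \<open>The sign is inherited from the max-norm that \<open>sqrt G\<close> dominates.
      It serves both to multiply the norm bounds and to replace \<open>sqrt G * sqrt G\<close> by
      \<open>G\<close>.\<close>
    have sqrt_G: "0 \<le> sqrt G"
      using max_norm_nonneg XY(2) by (rule order_trans)
    have "\<bar>alg \<epsilon> ?X ?Y $ i $ j - (A ** B) $ i $ j\<bar> \<le> \<bar>c\<bar> * \<epsilon> * G" for i j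
    proof -
      have "\<bar>alg \<epsilon> ?X ?Y $ i $ j - (A ** B) $ i $ j\<bar> \<le> c * \<epsilon> * (max_norm ?X * max_norm ?Y)"
        using c[OF \<epsilon>, of ?X ?Y i j] XY(1) by (simp add: abs_minus_commute mult.assoc)
      also have "\<dots> \<le> \<bar>c\<bar> * \<epsilon> * (sqrt G * sqrt G)"
        using assms(1)[OF \<epsilon>] XY(2,3) sqrt_G
        by (intro mult_mono mult_right_mono) (auto simp: max_norm_nonneg)
      finally show ?thesis
        using sqrt_G by simp
    qed
    then show "max_norm (inside_scaled_product alg \<epsilon> A B - A ** B)
        \<le> \<bar>c\<bar> * \<epsilon> * (MAX (i, k, j). \<bar>A $ i $ k\<bar> * \<bar>B $ k $ j\<bar>)"
      by (simp add: max_norm_le_iff inside_scaled_product_def Let_def flip: D_def G_def)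
  qed
qed

end
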